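(* Among the quadratic order preserving maps with $\tau(E)=\mathrm{tr}[E]$, the Fisher information map $F$ is the most informative: it is at least as informative as any other quadratic order preserving map. That is, for all $D,r\geq1$ and every linear map $\Phi:M_d(\mathbb{C})\to M_{D\times r}(\mathbb{C})$, with $G$ the associated map $G(\mathsf{A})=\sum_x \Phi(\mathsf{A}_x)\Phi(\mathsf{A}_x)^*/\mathrm{tr}[\mathsf{A}_x]$, one has for all measurements $\mathsf{A},\mathsf{B}\in\mathcal{O}_d$ $$F([\mathsf{A}])\leq F([\mathsf{B}])\quad\Longrightarrow\quad G([\mathsf{A}])\leq G([\mathsf{B}]).$$
   Context: A measurement (POVM) $\mathsf{A}$ on $\mathbb{C}^d$ is a map $x\mapsto\mathsf{A}_x$ from a finite set of integers to $M_d(\mathbb{C})$ with $\mathsf{A}_x\geq0$ and $\sum_x\mathsf{A}_x=\mathbb{1}$; $\mathcal{O}_d$ is the set of all of them. Post-processing preorder: $\mathsf{A}\preccurlyeq\mathsf{B}$ if there is a matrix $(\mu_{xy})$ with nonnegative entries and $\sum_x\mu_{xy}=1$ for all $y$ such that $\mathsf{A}_x=\sum_y\mu_{xy}\mathsf{B}_y$ for all $x$. $[\mathsf{A}]$ denotes the class of $\mathsf{A}$ for the equivalence relation $\mathsf{A}\preccurlyeq\mathsf{B}\preccurlyeq\mathsf{A}$, and $\mathcal{O}_d^\sim$ the partially ordered set of classes. A quadratic order preserving map with $\tau(E)=\mathrm{tr}[E]$ is a map $G:\mathcal{O}_d^\sim\to\{\text{selfadjoint } D\times D\text{ matrices}\}$,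 $G([\mathsf{A}])=\sum_x\Phi(\mathsf{A}_x)\Phi(\mathsf{A}_x)^*/\mathrm{tr}[\mathsf{A}_x]$ (terms with $\mathsf{A}_x=0$ omitted), for a linear map $\Phi:M_d(\mathbb{C})\to M_{D\times r}(\mathbb{C})$; it is well defined on classes and order preserving. The Fisher information map $F$ is the one given by $\Phi(E)=|E\rangle$, i.e. $F([\mathsf{A}])=\sum_x|\mathsf{A}_x\rangle\langle\mathsf{A}_x|/\mathrm{tr}[\mathsf{A}_x]\in M_{d^2}(\mathbb{C})$, where $|E\rangle=\sum_{j,k=1}^d\langle k|E|j\rangle\,|j\rangle\otimes|k\rangle\in\mathbb{C}^{d^2}$ is the vectorization of $E$ in an orthonormal basis and $\langle E|$ is its conjugate transpose. Matrices are ordered by the positive semidefinite order. For order preserving maps $G,G'$ on $\mathcal{O}_d^\sim$, $G$ is at least as informative as $G'$ if for all measurements $\mathsf{A},\mathsf{B}$, $G([\mathsf{A}])\leq G([\mathsf{B}])$ implies $G'([\mathsf{A}])\leq G'([\mathsf{B}])$. *)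

theory Defs
  imports "HOL-Analysis.Analysis"
begin

text \<open>A \<open>D \<times> r\<close> matrix is \<^typ>\<open>complex^'r^'D\<close>, with the row index first: \<open>M $ i $ j\<close>.\<close>

definition mat_scale :: "complex \<Rightarrow> complex^'n^'m \<Rightarrow> complex^'n^'m"
  where "mat_scale c M = map_matrix ((*) c) M"

text \<open>The library's unqualified \<open>linear\<close> is linearity over the reals.\<close>

abbreviation complex_linear :: "(complex^'n^'m \<Rightarrow> complex^'l^'k) \<Rightarrow> bool"
  where "complex_linear \<equiv> Vector_Spaces.linear mat_scale mat_scale"

definition mat_adjoint :: "complex^'n^'m \<Rightarrow> complex^'m^'n"
  where "mat_adjoint M = transpose (map_matrix cnj M)"

definition cinner :: "complex^'n \<Rightarrow> complex^'n \<Rightarrow> complex"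
  where "cinner u v = (\<Sum>i\<in>UNIV. cnj (u $ i) * v $ i)"

definition selfadjoint :: "complex^'n^'n \<Rightarrow> bool"
  where "selfadjoint M \<longleftrightarrow> mat_adjoint M = M"

definition psd :: "complex^'n^'n \<Rightarrow> bool"
  where "psd M \<longleftrightarrow> selfadjoint M \<and> (\<forall>v. 0 \<le> Re (cinner v (M *v v)))"

text \<open>A separate symbol is needed because \<open>\<le>\<close> on vectors is the componentwise order.\<close>

definition psd_le :: "complex^'n^'n \<Rightarrow> complex^'n^'n \<Rightarrow> bool"  (infix \<open>\<sqsubseteq>\<close> 50)
  where "M \<sqsubseteq> N \<longleftrightarrow> psd (N - M)"

definition orthonormal_basis :: "('d \<Rightarrow> complex^'d) \<Rightarrow> bool"
  where "orthonormal_basis b \<longleftrightarrow> (\<forall>j k. cinner (b j) (b k) = (if j = k then 1 else 0))"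

definition tensor :: "complex^'m \<Rightarrow> complex^'n \<Rightarrow> complex^('m \<times> 'n)"
  where "tensor u v = (\<chi> p. u $ fst p * v $ snd p)"

text \<open>\<open>|E\<rangle>\<close>, with respect to the basis \<open>b\<close>: the coefficient of \<open>|j\<rangle> \<otimes> |k\<rangle>\<close> is
  \<open>\<langle>k|E|j\<rangle>\<close>.\<close>

definition vectorize :: "('d \<Rightarrow> complex^'d) \<Rightarrow> complex^'d^'d \<Rightarrow> complex^('d \<times> 'd)"
  where "vectorize b E = (\<Sum>j\<in>UNIV. \<Sum>k\<in>UNIV. cinner (b k) (E *v b j) *s tensor (b j) (b k))"

typedef (overloaded) ('d::finite) measurement =
  "{A :: int \<rightharpoonup> complex^'d^'d. finite (dom A) \<and> (\<forall>x\<in>dom A. psd (the (A x))) \<and>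
     (\<Sum>x\<in>dom A. the (A x)) = mat 1}"
  morphisms measurement_map Measurement
proof
  let ?A = "[0 \<mapsto> mat 1] :: int \<rightharpoonup> complex^'d^'d"
  have "psd (mat 1 :: complex^'d^'d)"
    by (auto simp: psd_def selfadjoint_def mat_adjoint_def transpose_def map_matrix_def mat_def
        vec_eq_iff)
       (simp add: mat_def[symmetric] cinner_def sum_nonneg)
  then show "?A \<in> {A. finite (dom A) \<and> (\<forall>x\<in>dom A. psd (the (A x))) \<and>
     (\<Sum>x\<in>dom A. the (A x)) = mat 1}"
    by simp
qed

definition outcomes :: "'d::finite measurement \<Rightarrow> int set"
  where "outcomes A = dom (measurement_map A)"

definition effect :: "'d::finite measurement \<Rightarrow> int \<Rightarrow> complex^'d^'d"
  where "effect A x = the (measurement_map A x)"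

lemma
  fixes A :: "'d::finite measurement"
  shows finite_outcomes [simp]: "finite (outcomes A)"
    and effect_psd: "x \<in> outcomes A \<Longrightarrow> psd (effect A x)"
    and sum_effect: "(\<Sum>x\<in>outcomes A. effect A x) = mat 1"
  using measurement_map[of A] by (auto simp: outcomes_def effect_def)

definition postprocessing :: "'d::finite measurement \<Rightarrow> 'd measurement \<Rightarrow> bool"
    (infix \<open>\<preccurlyeq>\<close> 50)
  where "A \<preccurlyeq> B \<longleftrightarrow>
    (\<exists>\<mu> :: int \<Rightarrow> int \<Rightarrow> real.
       (\<forall>x\<in>outcomes A. \<forall>y\<in>outcomes B. 0 \<le> \<mu> x y) \<and>
       (\<forall>y\<in>outcomes B. (\<Sum>x\<in>outcomes A. \<mu> x y) = 1) \<and>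
       (\<forall>x\<in>outcomes A. effect A x = (\<Sum>y\<in>outcomes B. \<mu> x y *\<^sub>R effect B y)))"

lemma postprocessing_refl: "A \<preccurlyeq> A"
  unfolding postprocessing_def
  by (rule exI[of _ "\<lambda>x y. if x = y then 1 else 0"])
     (auto simp: if_distrib[where f = "\<lambda>c. c *\<^sub>R _"] sum.delta sum.delta' cong: if_cong)

lemma postprocessing_trans:
  assumes "A \<preccurlyeq> B" "B \<preccurlyeq> C"
  shows "A \<preccurlyeq> C"
proof -
  obtain \<mu> where m: "\<And>x y. x \<in> outcomes A \<Longrightarrow> y \<in> outcomes B \<Longrightarrow> 0 \<le> \<mu> x y"
    "\<And>y. y \<in> outcomes B \<Longrightarrow> (\<Sum>x\<in>outcomes A. \<mu> x y) = (1::real)"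
    "\<And>x. x \<in> outcomes A \<Longrightarrow> effect A x = (\<Sum>y\<in>outcomes B. \<mu> x y *\<^sub>R effect B y)"
    using assms(1) unfolding postprocessing_def by blast
  obtain \<nu> where n: "\<And>x y. x \<in> outcomes B \<Longrightarrow> y \<in> outcomes C \<Longrightarrow> 0 \<le> \<nu> x y"
    "\<And>y. y \<in> outcomes C \<Longrightarrow> (\<Sum>x\<in>outcomes B. \<nu> x y) = (1::real)"
    "\<And>x. x \<in> outcomes B \<Longrightarrow> effect B x = (\<Sum>y\<in>outcomes C. \<nu> x y *\<^sub>R effect C y)"
    using assms(2) unfolding postprocessing_def by blast
  let ?k = "\<lambda>x z. \<Sum>y\<in>outcomes B. \<mu> x y * \<nu> y z"
  show ?thesis
    unfolding postprocessing_def
  proof (intro exI[of _ ?k] conjI ballI)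
    show "0 \<le> ?k x z" if "x \<in> outcomes A" "z \<in> outcomes C" for x z
      using that m(1) n(1) by (intro sum_nonneg) simp
    show "(\<Sum>x\<in>outcomes A. ?k x z) = 1" if "z \<in> outcomes C" for z
    proof -
      have "(\<Sum>x\<in>outcomes A. ?k x z) = (\<Sum>y\<in>outcomes B. (\<Sum>x\<in>outcomes A. \<mu> x y) * \<nu> y z)"
        by (subst sum.swap) (simp add: sum_distrib_right)
      also have "\<dots> = 1" using m(2) n(2) that by simp
      finally show ?thesis .
    qed
    show "effect A x = (\<Sum>z\<in>outcomes C. ?k x z *\<^sub>R effect C z)" if "x \<in> outcomes A" for x
    proof -
      have "effect A x = (\<Sum>y\<in>outcomes B. \<Sum>z\<in>outcomes C. (\<mu> x y * \<nu> y z) *\<^sub>R effect C z)"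
        using m(3)[OF that] n(3) by (simp add: scaleR_sum_right)
      then show ?thesis by (subst (asm) sum.swap) (simp add: scaleR_sum_left)
    qed
  qed
qed

definition postprocessing_equiv :: "'d::finite measurement \<Rightarrow> 'd measurement \<Rightarrow> bool"
  where "postprocessing_equiv A B \<longleftrightarrow> A \<preccurlyeq> B \<and> B \<preccurlyeq> A"

quotient_type (overloaded) 'd measurement_class = "'d::finite measurement" / postprocessing_equiv
  morphisms representative class_of
  by (intro equivpI reflpI sympI transpI)
     (auto simp: postprocessing_equiv_def intro: postprocessing_refl postprocessing_trans)

instantiation measurement_class :: (finite) order
begin

lift_definition less_eq_measurement_class :: "'a measurement_class \<Rightarrow> 'a measurement_class \<Rightarrow> bool"
  is postprocessing
  by (auto simp: postprocessing_equiv_def intro: postprocessing_trans)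

definition less_measurement_class :: "'a measurement_class \<Rightarrow> 'a measurement_class \<Rightarrow> bool"
  where "less_measurement_class a b \<longleftrightarrow> a \<le> b \<and> \<not> b \<le> a"

instance
  by standard
     (unfold less_measurement_class_def,
      (transfer; auto simp: postprocessing_equiv_def
         intro: postprocessing_refl postprocessing_trans)+)

end

definition order_preserving :: "('d::finite measurement_class \<Rightarrow> complex^'D^'D) \<Rightarrow> bool"
  where "order_preserving G \<longleftrightarrow>
    (\<forall>a. selfadjoint (G a)) \<and> (\<forall>a b. a \<le> b \<longrightarrow> G a \<sqsubseteq> G b)"

definition at_least_as_informative ::
    "('d::finite measurement_class \<Rightarrow> complex^'D^'D) \<Rightarrow> ('d measurement_class \<Rightarrow> complex^'E^'E) \<Rightarrow> bool"
  where "at_least_as_informative G G' \<longleftrightarrow>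
    (\<forall>A B. G (class_of A) \<sqsubseteq> G (class_of B) \<longrightarrow> G' (class_of A) \<sqsubseteq> G' (class_of B))"

definition quadratic_sum ::
    "(complex^'d^'d \<Rightarrow> complex^'r^'D) \<Rightarrow> 'd::finite measurement \<Rightarrow> complex^'D^'D"
  where "quadratic_sum \<Phi> A =
    (\<Sum>x | x \<in> outcomes A \<and> effect A x \<noteq> 0.
       mat_scale (1 / trace (effect A x)) (\<Phi> (effect A x) ** mat_adjoint (\<Phi> (effect A x))))"

text \<open>For complex linear \<open>\<Phi>\<close> the value does not depend on the representative; see
  \<open>quadratic_map_class_of\<close> below.\<close>

definition quadratic_map ::
    "(complex^'d^'d \<Rightarrow> complex^'r^'D) \<Rightarrow> 'd::finite measurement_class \<Rightarrow> complex^'D^'D"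
  where "quadratic_map \<Phi> a = quadratic_sum \<Phi> (representative a)"

text \<open>\<^const>\<open>columnvector\<close> turns \<open>|E\<rangle>\<close> into a matrix with a single column.\<close>

definition fisher_map ::
    "('d \<Rightarrow> complex^'d) \<Rightarrow> 'd::finite measurement_class \<Rightarrow> complex^('d \<times> 'd)^('d \<times> 'd)"
  where "fisher_map b =
    quadratic_map (\<lambda>E. columnvector (vectorize b E) :: complex^1^('d \<times> 'd))"

lemma vector_space_mat_scale: "vector_space (mat_scale :: complex \<Rightarrow> complex^'n^'m \<Rightarrow> _)"
  by unfold_locales (auto simp: mat_scale_def map_matrix_def vec_eq_iff algebra_simps)

lemma complex_linear_iff:
  "complex_linear \<Phi> \<longleftrightarrow>
    (\<forall>E E'. \<Phi> (E + E') = \<Phi> E + \<Phi> E') \<and> (\<forall>c E. \<Phi> (mat_scale c E) = mat_scale c (\<Phi> E))"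
  by (simp add: Vector_Spaces.linear_iff vector_space_mat_scale)

lemma mat_scale_of_real: "mat_scale (complex_of_real c) M = c *\<^sub>R M"
  unfolding mat_scale_def map_matrix_def vec_eq_iff by (simp add: scaleR_conv_of_real[where 'a = complex])

lemma complex_linear_imp_linear:
  assumes "complex_linear \<Phi>"
  shows "linear \<Phi>"
proof (rule linearI)
  show "\<Phi> (E + E') = \<Phi> E + \<Phi> E'" for E E'
    using assms unfolding complex_linear_iff by blast
  show "\<Phi> (c *\<^sub>R E) = c *\<^sub>R \<Phi> E" for c E
    using assms unfolding complex_linear_iff mat_scale_of_real[symmetric] by blast
qed

lemma cinner_self: "cinner v v = complex_of_real ((norm v)\<^sup>2)"
proof -
  have "(norm v)\<^sup>2 = (\<Sum>i\<in>UNIV. (cmod (v $ i))\<^sup>2)"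
    by (simp add: norm_vec_def L2_set_def sum_nonneg)
  then show ?thesis
    by (simp only: cinner_def of_real_sum complex_norm_square mult.commute)
qed

lemma cinner_mat_adjoint: "cinner u (M *v w) = cinner (mat_adjoint M *v u) w"
proof -
  have "cinner u (M *v w) = (\<Sum>i\<in>UNIV. \<Sum>j\<in>UNIV. cnj (u $ i) * (M $ i $ j * w $ j))"
    by (simp add: cinner_def matrix_vector_mult_def sum_distrib_left)
  also have "\<dots> = (\<Sum>j\<in>UNIV. \<Sum>i\<in>UNIV. cnj (u $ i) * (M $ i $ j * w $ j))"
    by (rule sum.swap)
  also have "\<dots> = cinner (mat_adjoint M *v u) w"
    by (simp add: cinner_def matrix_vector_mult_def mat_adjoint_def transpose_def map_matrix_def
        sum_distrib_right sum_distrib_left ac_simps)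
  finally show ?thesis .
qed

lemma mat_adjoint_nth [simp]: "mat_adjoint M $ i $ j = cnj (M $ j $ i)"
  by (simp add: mat_adjoint_def transpose_def map_matrix_def)

lemma selfadjoint_iff: "selfadjoint M \<longleftrightarrow> (\<forall>i j. cnj (M $ j $ i) = M $ i $ j)"
  by (simp add: selfadjoint_def vec_eq_iff)

lemma cinner_add_right: "cinner u (v + w) = cinner u v + cinner u w"
  by (simp add: cinner_def algebra_simps sum.distrib)

lemma cinner_add_left: "cinner (u + v) w = cinner u w + cinner v w"
  by (simp add: cinner_def algebra_simps sum.distrib)

lemma cinner_diff_right: "cinner u (v - w) = cinner u v - cinner u w"
  by (simp add: cinner_def algebra_simps sum_subtractf)

lemma cinner_0_right: "cinner u 0 = 0"
  by (simp add: cinner_def)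

lemma cinner_axis_mat: "cinner (axis i c) (M *v axis j e) = cnj c * M $ i $ j * e"
  by (simp add: cinner_def axis_def matrix_vector_mult_def if_distrib[where f = cnj]
      if_distrib[where f = "\<lambda>x. x * _"] if_distrib[where f = "\<lambda>x. _ * x"] cong: if_cong)

lemma psd_diag_nonneg:
  assumes "psd M"
  shows "0 \<le> Re (M $ i $ i)"
  using assms cinner_axis_mat[of i 1 M i 1] by (auto simp: psd_def dest: spec[of _ "axis i 1"])

lemma psd_trace_nonneg: "psd M \<Longrightarrow> 0 \<le> Re (trace M)"
  by (simp add: trace_def sum_nonneg psd_diag_nonneg)

lemma psd_trace_of_real:
  assumes "psd M"
  shows "trace M = complex_of_real (Re (trace M))"
proof -
  have "Im (M $ i $ i) = 0" for i
  proof -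
    have "cnj (M $ i $ i) = M $ i $ i"
      using assms unfolding psd_def selfadjoint_iff by blast
    then show ?thesis by (simp add: complex_eq_iff)
  qed
  then show ?thesis by (simp add: complex_eq_iff trace_def)
qed

lemma psd_trace_eq_0:
  assumes M: "psd M" and tr: "Re (trace M) = 0"
  shows "M = 0"
proof -
  have diag: "Re (M $ i $ i) = 0" for i
    using tr psd_diag_nonneg[OF M] by (auto simp: trace_def sum_nonneg_eq_0_iff)
  have "M $ i $ j = 0" for i j
  proof -
    let ?z = "M $ i $ j"
    let ?v = "axis i 1 + axis j (- cnj ?z)"
    have ji: "M $ j $ i = cnj ?z" using M unfolding psd_def selfadjoint_iff by metis
    have zz: "?z * cnj ?z = complex_of_real ((cmod ?z)\<^sup>2)"
      by (rule complex_norm_square[symmetric])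
    have "0 \<le> Re (cinner ?v (M *v ?v))" using M by (simp add: psd_def)
    also have "cinner ?v (M *v ?v) =
        M $ i $ i - ?z * cnj ?z - ?z * cnj ?z + ?z * cnj ?z * M $ j $ j"
      unfolding matrix_vector_right_distrib cinner_add_right cinner_add_left cinner_axis_mat ji
      by (simp add: ac_simps)
    also have "Re \<dots> = - 2 * (cmod ?z)\<^sup>2"
      unfolding zz by (simp add: diag del: of_real_power)
    finally have "(cmod ?z)\<^sup>2 \<le> 0" by simp
    then show ?thesis by simp
  qed
  then show ?thesis by (simp add: vec_eq_iff)
qed

lemma psd_le_antisym:
  assumes "M \<sqsubseteq> N" "N \<sqsubseteq> M"
  shows "M = N"
proof -
  have "0 \<le> Re (trace (N - M))" "0 \<le> Re (trace (M - N))"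
    using assms psd_trace_nonneg unfolding psd_le_def by blast+
  then have "Re (trace (N - M)) = 0" by (simp add: trace_sub)
  then show ?thesis using psd_trace_eq_0 assms(1) unfolding psd_le_def by force
qed

lemma selfadjoint_add: "selfadjoint M \<Longrightarrow> selfadjoint N \<Longrightarrow> selfadjoint (M + N)"
  and selfadjoint_diff: "selfadjoint M \<Longrightarrow> selfadjoint N \<Longrightarrow> selfadjoint (M - N)"
  and selfadjoint_scaleR: "selfadjoint M \<Longrightarrow> selfadjoint (c *\<^sub>R M)"
  and selfadjoint_0: "selfadjoint 0"
  by (auto simp: selfadjoint_iff)

lemma selfadjoint_sum: "(\<And>x. x \<in> S \<Longrightarrow> selfadjoint (f x)) \<Longrightarrow> selfadjoint (sum f S)"
  by (induction S rule: infinite_finite_induct) (auto simp: selfadjoint_0 selfadjoint_add)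

lemma selfadjoint_mult_adjoint: "selfadjoint (M ** mat_adjoint M)"
  by (simp add: selfadjoint_iff matrix_matrix_mult_def mult.commute)

lemma quadratic_sum_alt:
  "quadratic_sum \<Phi> A =
    (\<Sum>x | x \<in> outcomes A \<and> effect A x \<noteq> 0.
       (1 / Re (trace (effect A x))) *\<^sub>R (\<Phi> (effect A x) ** mat_adjoint (\<Phi> (effect A x))))"
  unfolding quadratic_sum_def
proof (rule sum.cong[OF refl])
  fix x assume "x \<in> {x. x \<in> outcomes A \<and> effect A x \<noteq> 0}"
  then have "psd (effect A x)" by (simp add: effect_psd)
  from psd_trace_of_real[OF this]
  have "1 / trace (effect A x) = complex_of_real (1 / Re (trace (effect A x)))"
    by (metis of_real_1 of_real_divide)
  then show "mat_scale (1 / trace (effect A x)) (\<Phi> (effect A x) ** mat_adjoint (\<Phi> (effect A x))) =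
    (1 / Re (trace (effect A x))) *\<^sub>R (\<Phi> (effect A x) ** mat_adjoint (\<Phi> (effect A x)))"
    by (simp only: mat_scale_of_real)
qed

lemma selfadjoint_quadratic_sum: "selfadjoint (quadratic_sum \<Phi> A)"
  unfolding quadratic_sum_alt
  by (intro selfadjoint_sum selfadjoint_scaleR selfadjoint_mult_adjoint)

lemma Re_cinner_scaleR_mat: "Re (cinner v ((c *\<^sub>R M) *v v)) = c * Re (cinner v (M *v v))"
proof -
  have "(c *\<^sub>R M) *v v = c *\<^sub>R (M *v v)"
    by (simp add: vec_eq_iff matrix_vector_mult_def scaleR_sum_right)
  moreover have "cinner v (c *\<^sub>R u) = c *\<^sub>R cinner v u" for u
    by (simp add: cinner_def scaleR_sum_right)
  ultimately show ?thesis by simp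
qed

lemma Re_cinner_sum_mat: "Re (cinner v (sum f S *v v)) = (\<Sum>x\<in>S. Re (cinner v (f x *v v)))"
  by (induction S rule: infinite_finite_induct)
     (simp_all add: cinner_add_right matrix_vector_mult_add_rdistrib cinner_0_right)

lemma Re_cinner_mult_adjoint:
  "Re (cinner v ((M ** mat_adjoint M) *v v)) = (norm (mat_adjoint M *v v))\<^sup>2"
  by (simp add: matrix_vector_mul_assoc[symmetric] cinner_mat_adjoint cinner_self del: of_real_power)

lemma quadratic_form_quadratic_sum:
  assumes "complex_linear \<Phi>"
  shows "Re (cinner v (quadratic_sum \<Phi> A *v v)) =
    (\<Sum>x\<in>outcomes A. (norm (mat_adjoint (\<Phi> (effect A x)) *v v))\<^sup>2 / Re (trace (effect A x)))"
proof -
  have "Re (cinner v (quadratic_sum \<Phi> A *v v)) =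
    (\<Sum>x | x \<in> outcomes A \<and> effect A x \<noteq> 0.
       (norm (mat_adjoint (\<Phi> (effect A x)) *v v))\<^sup>2 / Re (trace (effect A x)))"
    unfolding quadratic_sum_alt Re_cinner_sum_mat
    by (rule sum.cong) (simp_all only: Re_cinner_scaleR_mat Re_cinner_mult_adjoint, simp)
  also have "\<dots> =
    (\<Sum>x\<in>outcomes A. (norm (mat_adjoint (\<Phi> (effect A x)) *v v))\<^sup>2 / Re (trace (effect A x)))"
    by (rule sum.mono_neutral_left) (auto simp: trace_def)
  finally show ?thesis .
qed

lemma weighted_square_bound:
  fixes m s t :: "'i \<Rightarrow> real"
  assumes "finite S" and m: "\<And>i. i \<in> S \<Longrightarrow> 0 \<le> m i" and t: "\<And>i. i \<in> S \<Longrightarrow> 0 \<le> t i"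
    and s: "\<And>i. i \<in> S \<Longrightarrow> t i = 0 \<Longrightarrow> s i = 0"
  shows "(\<Sum>i\<in>S. m i * s i)\<^sup>2 / (\<Sum>i\<in>S. m i * t i) \<le> (\<Sum>i\<in>S. m i * ((s i)\<^sup>2 / t i))"
proof (cases "(\<Sum>i\<in>S. m i * t i) = 0")
  case True
  have "0 \<le> (\<Sum>i\<in>S. m i * ((s i)\<^sup>2 / t i))"
    by (intro sum_nonneg mult_nonneg_nonneg divide_nonneg_nonneg m t) simp_all
  then show ?thesis using True by simp
next
  case False
  have pos: "0 < (\<Sum>i\<in>S. m i * t i)"
  proof (rule order.not_eq_order_implies_strict)
    show "0 \<noteq> (\<Sum>i\<in>S. m i * t i)" using False by simp
    show "0 \<le> (\<Sum>i\<in>S. m i * t i)" by (intro sum_nonneg mult_nonneg_nonneg m t)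
  qed
  have "(\<Sum>i\<in>S. m i * s i) = (\<Sum>i\<in>S. sqrt (m i * t i) * (sqrt (m i / t i) * s i))"
  proof (rule sum.cong[OF refl])
    fix i assume i: "i \<in> S"
    show "m i * s i = sqrt (m i * t i) * (sqrt (m i / t i) * s i)"
    proof (cases "t i = 0")
      case True then show ?thesis using s i by simp
    next
      case False
      then have "sqrt (m i * t i) * sqrt (m i / t i) = m i"
        using m[OF i] t[OF i] by (simp add: real_sqrt_mult[symmetric])
      then show ?thesis by (simp add: mult.assoc[symmetric])
    qed
  qed
  then have "(\<Sum>i\<in>S. m i * s i)\<^sup>2 \<le>
      (\<Sum>i\<in>S. (sqrt (m i * t i))\<^sup>2) * (\<Sum>i\<in>S. (sqrt (m i / t i) * s i)\<^sup>2)"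
    using Cauchy_Schwarz_ineq_sum[of "\<lambda>i. sqrt (m i * t i)" "\<lambda>i. sqrt (m i / t i) * s i" S] by simp
  also have "(\<Sum>i\<in>S. (sqrt (m i * t i))\<^sup>2) = (\<Sum>i\<in>S. m i * t i)"
    by (rule sum.cong) (use m t in auto)
  also have "(\<Sum>i\<in>S. (sqrt (m i / t i) * s i)\<^sup>2) = (\<Sum>i\<in>S. m i * ((s i)\<^sup>2 / t i))"
    by (rule sum.cong) (use m t in \<open>auto simp: power_mult_distrib\<close>)
  finally show ?thesis using pos by (simp add: divide_le_eq mult.commute)
qed

lemma linear_adjoint_apply:
  assumes "complex_linear \<Phi>"
  shows "linear (\<lambda>E. mat_adjoint (\<Phi> E) *v v)"
proof -
  interpret linear \<Phi> by (rule complex_linear_imp_linear[OF assms])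
  show ?thesis
    by (rule linearI)
       (simp_all add: add scale vec_eq_iff matrix_vector_mult_def distrib_right sum.distrib
         scaleR_sum_right)
qed

lemma linear_Re_trace: "linear (\<lambda>E :: complex^'d^'d. Re (trace E))"
  by (rule linearI) (simp_all add: trace_def sum.distrib sum_distrib_left)

lemma quadratic_sum_mono:
  assumes \<Phi>: "complex_linear \<Phi>" and "A \<preccurlyeq> B"
  shows "quadratic_sum \<Phi> A \<sqsubseteq> quadratic_sum \<Phi> B"
proof -
  obtain \<mu> where m: "\<And>x y. x \<in> outcomes A \<Longrightarrow> y \<in> outcomes B \<Longrightarrow> 0 \<le> \<mu> x y"
    "\<And>y. y \<in> outcomes B \<Longrightarrow> (\<Sum>x\<in>outcomes A. \<mu> x y) = (1::real)"
    "\<And>x. x \<in> outcomes A \<Longrightarrow> effect A x = (\<Sum>y\<in>outcomes B. \<mu> x y *\<^sub>R effect B y)"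
    using assms(2) unfolding postprocessing_def by blast
  have "Re (cinner v (quadratic_sum \<Phi> A *v v)) \<le> Re (cinner v (quadratic_sum \<Phi> B *v v))" for v
  proof -
    define w where "w E = mat_adjoint (\<Phi> E) *v v" for E
    define t where "t E = Re (trace E)" for E :: "complex^'a^'a"
    have lw: "linear w" unfolding w_def by (rule linear_adjoint_apply[OF \<Phi>])
    have lt: "linear t" unfolding t_def by (rule linear_Re_trace)
    have step: "(norm (w (effect A x)))\<^sup>2 / t (effect A x) \<le>
        (\<Sum>y\<in>outcomes B. \<mu> x y * ((norm (w (effect B y)))\<^sup>2 / t (effect B y)))"
      if x: "x \<in> outcomes A" for x
    proof -
      have "norm (w (effect A x)) = norm (\<Sum>y\<in>outcomes B. \<mu> x y *\<^sub>R w (effect B y))"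
        unfolding m(3)[OF x] by (simp add: linear_sum[OF lw] linear_scale[OF lw])
      also have "\<dots> \<le> (\<Sum>y\<in>outcomes B. norm (\<mu> x y *\<^sub>R w (effect B y)))"
        by (rule norm_sum)
      also have "\<dots> = (\<Sum>y\<in>outcomes B. \<mu> x y * norm (w (effect B y)))"
        by (rule sum.cong) (use m(1)[OF x] in auto)
      finally have n: "norm (w (effect A x)) \<le> (\<Sum>y\<in>outcomes B. \<mu> x y * norm (w (effect B y)))" .
      have tA: "t (effect A x) = (\<Sum>y\<in>outcomes B. \<mu> x y * t (effect B y))"
        unfolding m(3)[OF x] by (simp add: linear_sum[OF lt] linear_scale[OF lt])
      have tB: "0 \<le> t (effect B y)" if "y \<in> outcomes B" for y
        unfolding t_def by (rule psd_trace_nonneg[OF effect_psd[OF that]])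
      have "(norm (w (effect A x)))\<^sup>2 / t (effect A x) \<le>
          (\<Sum>y\<in>outcomes B. \<mu> x y * norm (w (effect B y)))\<^sup>2 / (\<Sum>y\<in>outcomes B. \<mu> x y * t (effect B y))"
        unfolding tA by (intro divide_right_mono power_mono n sum_nonneg) (use m(1)[OF x] tB in auto)
      also have "\<dots> \<le> (\<Sum>y\<in>outcomes B. \<mu> x y * ((norm (w (effect B y)))\<^sup>2 / t (effect B y)))"
      proof (rule weighted_square_bound)
        fix y assume y: "y \<in> outcomes B" and "t (effect B y) = 0"
        then have "effect B y = 0" using psd_trace_eq_0[OF effect_psd[OF y]] by (simp add: t_def)
        then show "norm (w (effect B y)) = 0" using linear_0[OF lw] by simp
      qed (use m(1)[OF x] tB in auto)
      finally show ?thesis .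
    qed
    have "(\<Sum>x\<in>outcomes A. (norm (w (effect A x)))\<^sup>2 / t (effect A x)) \<le>
        (\<Sum>x\<in>outcomes A. \<Sum>y\<in>outcomes B. \<mu> x y * ((norm (w (effect B y)))\<^sup>2 / t (effect B y)))"
      by (rule sum_mono) (rule step)
    also have "\<dots> = (\<Sum>y\<in>outcomes B. (\<Sum>x\<in>outcomes A. \<mu> x y) * ((norm (w (effect B y)))\<^sup>2 / t (effect B y)))"
      by (subst sum.swap) (simp only: sum_distrib_right)
    also have "\<dots> = (\<Sum>y\<in>outcomes B. (norm (w (effect B y)))\<^sup>2 / t (effect B y))"
      by (rule sum.cong) (use m(2) in auto)
    finally show ?thesis
      by (simp only: quadratic_form_quadratic_sum[OF \<Phi>] w_def t_def)
  qed
  then show ?thesis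
    unfolding psd_le_def psd_def
    by (simp add: selfadjoint_diff selfadjoint_quadratic_sum matrix_vector_mult_diff_rdistrib
        cinner_diff_right)
qed

lemma quadratic_map_class_of:
  assumes "complex_linear \<Phi>"
  shows "quadratic_map \<Phi> (class_of A) = quadratic_sum \<Phi> A"
proof -
  have "postprocessing_equiv (representative (class_of A)) A"
    by (rule Quotient3_rep_abs[OF Quotient3_measurement_class])
       (simp add: postprocessing_equiv_def postprocessing_refl)
  then show ?thesis
    unfolding quadratic_map_def postprocessing_equiv_def
    by (intro psd_le_antisym quadratic_sum_mono[OF assms]) auto
qed

lemma order_preserving_quadratic_map:
  assumes "complex_linear \<Phi>"
  shows "order_preserving (quadratic_map \<Phi>)"
  unfolding order_preserving_def
proof (intro conjI allI impI)
  show "selfadjoint (quadratic_map \<Phi> a)" for a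
    by (simp add: quadratic_map_def selfadjoint_quadratic_sum)
  show "quadratic_map \<Phi> a \<sqsubseteq> quadratic_map \<Phi> b" if "a \<le> b" for a b
  proof -
    obtain A B where ab: "a = class_of A" "b = class_of B"
      by (metis Quotient3_abs_rep[OF Quotient3_measurement_class])
    have "A \<preccurlyeq> B" using that unfolding ab by transfer
    then show ?thesis unfolding ab quadratic_map_class_of[OF assms] by (rule quadratic_sum_mono[OF assms])
  qed
qed

lemma complex_linear_columnvector_vectorize:
  fixes b :: "'d::finite \<Rightarrow> complex^'d"
  shows "complex_linear (\<lambda>E. columnvector (vectorize b E) :: complex^1^('d \<times> 'd))"
proof -
  have cinner_scale: "cinner u (c *s v) = c * cinner u v" for c and u v :: "complex^'d"
    by (simp add: cinner_def sum_distrib_left mult.left_commute)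
  have mat_scale_mult: "mat_scale c E *v u = c *s (E *v u)" for c and E :: "complex^'d^'d" and u
    by (simp add: vec_eq_iff matrix_vector_mult_def mat_scale_def map_matrix_def sum_distrib_left
        mult.assoc)
  have "vectorize b (E + E') = vectorize b E + vectorize b E'" for E E'
    by (simp only: vectorize_def matrix_vector_mult_add_rdistrib cinner_add_right
        vec.scale_left_distrib sum.distrib)
  moreover have "vectorize b (mat_scale c E) = c *s vectorize b E" for c E
    by (simp only: vectorize_def mat_scale_mult cinner_scale vector_smult_assoc[symmetric]
        vec.scale_sum_right)
  ultimately show ?thesis
    unfolding complex_linear_iff
    by (simp add: columnvector_def mat_scale_def map_matrix_def vec_eq_iff)
qed

lemma fisher_map_class_of:
  "fisher_map b (class_of A) =
    (\<Sum>x | x \<in> outcomes A \<and> effect A x \<noteq> 0.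
       mat_scale (1 / trace (effect A x))
         (\<chi> p q. vectorize b (effect A x) $ p * cnj (vectorize b (effect A x) $ q)))"
proof -
  have "columnvector u ** mat_adjoint (columnvector u :: complex^1^('a \<times> 'a)) =
      (\<chi> p q. u $ p * cnj (u $ q))" for u :: "complex^('a \<times> 'a)"
    by (simp add: vec_eq_iff matrix_matrix_mult_def columnvector_def)
  then show ?thesis
    unfolding fisher_map_def quadratic_map_class_of[OF complex_linear_columnvector_vectorize]
      quadratic_sum_def by simp
qed

lemma order_preserving_fisher_map: "order_preserving (fisher_map b)"
  unfolding fisher_map_def
  by (rule order_preserving_quadratic_map[OF complex_linear_columnvector_vectorize])

end

theory Submission
  imports Defs
begin

text \<open>
  The entries of \<open>\<Phi>(E)\<^sup>* v\<close> are conjugates of linear functionals of \<open>E\<close>, and every linear functional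
  of \<open>E\<close> is an inner product with \<open>|E\<rangle>\<close>.  So there are vectors \<open>w\<^sub>i\<close>, depending on \<open>v\<close> but not on
  \<open>E\<close>, with \<open>\<parallel>\<Phi>(E)\<^sup>* v\<parallel>\<^sup>2 = (\<Sum>i. \<bar>\<langle>E|w\<^sub>i\<rangle>\<bar>\<^sup>2)\<close>, and hence
  \<open>\<langle>v|G(A)|v\<rangle> = (\<Sum>i. \<langle>w\<^sub>i|F(A)|w\<^sub>i\<rangle>)\<close> for every measurement \<open>A\<close>.
\<close>

text \<open>The rank-one operator |u><v|. For an orthonormal basis \<open>b\<close> the matrices
  \<open>ketbra (b k) (b j)\<close> serve as matrix units of that basis.\<close>

definition ketbra :: "complex^'m \<Rightarrow> complex^'n \<Rightarrow> complex^'n^'m"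
  where "ketbra u v = (\<chi> i l. u $ i * cnj (v $ l))"

text \<open>Orthonormality says that the matrix \<open>B\<close> with columns \<open>b j\<close> has
  \<open>mat_adjoint B\<close> as a left inverse. As \<open>B\<close> is square, this is also a
  right inverse, and the entries of that product give the completeness relation.\<close>

lemma orthonormal_basis_complete:
  fixes b :: "'d::finite \<Rightarrow> complex^'d"
  assumes "orthonormal_basis b"
  shows "(\<Sum>j\<in>UNIV. b j $ a * cnj (b j $ c)) = (if a = c then 1 else 0)"
proof -
  define B :: "complex^'d^'d" where "B = (\<chi> i j. b j $ i)"
  have "mat_adjoint B ** B = mat 1"
    using assms
    by (simp add: vec_eq_iff matrix_matrix_mult_def B_def mat_def orthonormal_basis_def cinner_def)
  then have "B ** mat_adjoint B = mat 1"
    by (simp add: matrix_left_right_inverse)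
  then have "(B ** mat_adjoint B) $ a $ c = mat 1 $ a $ c"
    by simp
  then show ?thesis
    by (simp add: matrix_matrix_mult_def B_def mat_def)
qed

lemma orthonormal_basis_vector_expansion:
  fixes b :: "'d::finite \<Rightarrow> complex^'d"
  assumes "orthonormal_basis b"
  shows "(\<Sum>k\<in>UNIV. cinner (b k) u * b k $ i) = u $ i"
proof -
  have "(\<Sum>k\<in>UNIV. cinner (b k) u * b k $ i) =
      (\<Sum>k\<in>UNIV. \<Sum>a\<in>UNIV. u $ a * (b k $ i * cnj (b k $ a)))"
    by (simp add: cinner_def sum_distrib_left sum_distrib_right ac_simps)
  also have "\<dots> = (\<Sum>a\<in>UNIV. u $ a * (\<Sum>k\<in>UNIV. b k $ i * cnj (b k $ a)))"
    by (subst sum.swap) (simp add: sum_distrib_left)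
  also have "\<dots> = u $ i"
    by (simp add: orthonormal_basis_complete[OF assms] if_distrib[where f = "\<lambda>x. _ * x"]
        cong: if_cong)
  finally show ?thesis .
qed

text \<open>Completeness is inserted on both sides of \<open>E\<close>. The coefficients are exactly
  those of \<open>vectorize b E\<close>, so a map that respects sums and scalars can be read off
  from the vectorization.\<close>

lemma orthonormal_basis_matrix_expansion:
  fixes b :: "'d::finite \<Rightarrow> complex^'d"
  assumes "orthonormal_basis b"
  shows "E = (\<Sum>j\<in>UNIV. \<Sum>k\<in>UNIV. mat_scale (cinner (b k) (E *v b j)) (ketbra (b k) (b j)))"
proof -
  have "(\<Sum>j\<in>UNIV. \<Sum>k\<in>UNIV. mat_scale (cinner (b k) (E *v b j)) (ketbra (b k) (b j))) $ i $ l =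
      E $ i $ l" for i l
  proof -
    have "(\<Sum>j\<in>UNIV. \<Sum>k\<in>UNIV. mat_scale (cinner (b k) (E *v b j)) (ketbra (b k) (b j))) $ i $ l =
        (\<Sum>j\<in>UNIV. (\<Sum>k\<in>UNIV. cinner (b k) (E *v b j) * b k $ i) * cnj (b j $ l))"
      by (simp add: mat_scale_def map_matrix_def ketbra_def sum_distrib_right mult.assoc)
    also have "\<dots> = (\<Sum>j\<in>UNIV. \<Sum>m\<in>UNIV. E $ i $ m * (b j $ m * cnj (b j $ l)))"
      by (simp add: orthonormal_basis_vector_expansion[OF assms] matrix_vector_mult_def
          sum_distrib_right mult.assoc)
    also have "\<dots> = (\<Sum>m\<in>UNIV. E $ i $ m * (\<Sum>j\<in>UNIV. b j $ m * cnj (b j $ l)))"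
      by (subst sum.swap) (simp add: sum_distrib_left)
    also have "\<dots> = E $ i $ l"
      by (simp add: orthonormal_basis_complete[OF assms] if_distrib[where f = "\<lambda>x. _ * x"]
          cong: if_cong)
    finally show ?thesis .
  qed
  then show ?thesis by (simp add: vec_eq_iff)
qed

lemma cinner_commute: "cinner v u = cnj (cinner u v)"
  by (simp add: cinner_def mult.commute)

lemma cinner_sum_right: "cinner u (sum f S) = (\<Sum>i\<in>S. cinner u (f i))"
  by (induction S rule: infinite_finite_induct) (simp_all add: cinner_0_right cinner_add_right)

lemma cinner_scale_right: "cinner u (c *s v) = c * cinner u v"
  by (simp add: cinner_def sum_distrib_left mult.left_commute)

lemma cinner_tensor: "cinner (tensor u v) (tensor u' v') = cinner u u' * cinner v v'"
proof -
  have "cinner (tensor u v) (tensor u' v') =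
      (\<Sum>(i, j)\<in>UNIV \<times> UNIV. (cnj (u $ i) * u' $ i) * (cnj (v $ j) * v' $ j))"
    by (simp add: cinner_def tensor_def case_prod_unfold ac_simps)
  then show ?thesis
    by (simp only: cinner_def sum_product sum.cartesian_product)
qed

text \<open>The vectors \<open>tensor (b j) (b k)\<close> are orthonormal, so pairing with one of
  them extracts its coefficient.\<close>

lemma cinner_tensor_vectorize:
  fixes b :: "'d::finite \<Rightarrow> complex^'d"
  assumes "orthonormal_basis b"
  shows "cinner (tensor (b j) (b k)) (vectorize b E) = cinner (b k) (E *v b j)"
proof -
  have "cinner (b i) (b l) = (if i = l then 1 else 0)" for i l
    using assms by (simp add: orthonormal_basis_def)
  then show ?thesis
    by (simp add: vectorize_def cinner_sum_right cinner_scale_right cinner_tensor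
        if_distrib[where f = "\<lambda>x. _ * x"] cong: if_cong)
qed

lemma mat_adjoint_columnvector: "(mat_adjoint (columnvector u :: complex^1^'n) *v w) $ i = cinner u w"
  by (simp add: matrix_vector_mult_def columnvector_def cinner_def)

lemma norm_adjoint_columnvector:
  "norm (mat_adjoint (columnvector u :: complex^1^'n::finite) *v w) = cmod (cinner u w)"
  by (simp add: norm_vec_def L2_set_def mat_adjoint_columnvector)

text \<open>Both sides are conjugate-linear in \<open>E\<close>, so it suffices to choose
  \<open>w i\<close> such that they agree on the matrix units
  \<open>ketbra (b k) (b j)\<close>.\<close>

lemma adjoint_apply_vectorize:
  fixes b :: "'d::finite \<Rightarrow> complex^'d" and \<Phi> :: "complex^'d^'d \<Rightarrow> complex^'r::finite^'D::finite"
  assumes b: "orthonormal_basis b" and \<Phi>: "complex_linear \<Phi>"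
  obtains w where "\<And>E i. (mat_adjoint (\<Phi> E) *v v) $ i = cinner (vectorize b E) (w i)"
proof -
  define g where "g E = mat_adjoint (\<Phi> E) *v v" for E
  have lin: "linear g"
    unfolding g_def by (rule linear_adjoint_apply[OF \<Phi>])
  \<comment> \<open>\<open>linear\<close> is only real linearity; over the complex numbers the
    adjoint makes \<open>g\<close> conjugate-linear. This conjugate matches the one in the first
    argument of \<open>cinner\<close>.\<close>
  have scale: "g (mat_scale c E) = cnj c *s g E" for c E
  proof -
    have "\<Phi> (mat_scale c E) = mat_scale c (\<Phi> E)"
      using \<Phi> unfolding complex_linear_iff by blast
    then show ?thesis
      by (simp add: g_def vec_eq_iff matrix_vector_mult_def mat_scale_def map_matrix_def
          sum_distrib_left mult.assoc)
  qed
  \<comment> \<open>The coefficients of \<open>w i\<close> are the values of component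
    \<open>i\<close> of \<open>g\<close> on the matrix units.\<close>
  define w where
    "w i = (\<Sum>j\<in>UNIV. \<Sum>k\<in>UNIV. g (ketbra (b k) (b j)) $ i *s tensor (b j) (b k))" for i
  have "g E $ i = cinner (vectorize b E) (w i)" for E i
  proof -
    have "cinner (vectorize b E) (tensor (b j) (b k)) = cnj (cinner (b k) (E *v b j))" for j k
      using cinner_tensor_vectorize[OF b] cinner_commute by metis
    then have "cinner (vectorize b E) (w i) =
        (\<Sum>j\<in>UNIV. \<Sum>k\<in>UNIV. g (mat_scale (cinner (b k) (E *v b j)) (ketbra (b k) (b j)))) $ i"
      by (simp add: w_def cinner_sum_right cinner_scale_right scale mult.commute)
    also have "\<dots> = g E $ i"
      \<comment> \<open>Only the \<open>E\<close> on the right-hand side is expanded; additivity of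
        \<open>g\<close> does the rest.\<close>
      by (subst (2) orthonormal_basis_matrix_expansion[OF b, of E]) (simp add: linear_sum[OF lin])
    finally show ?thesis by simp
  qed
  then show thesis
    using that unfolding g_def by blast
qed

text \<open>The index \<open>i\<close> runs over the components of \<Phi>(E)* v. The vectors
  \<open>w i\<close> are fixed before \<open>A\<close>, so one choice serves to compare two
  measurements.\<close>

lemma quadratic_form_eq_sum_fisher:
  fixes b :: "'d::finite \<Rightarrow> complex^'d" and \<Phi> :: "complex^'d^'d \<Rightarrow> complex^'r::finite^'D::finite"
  assumes b: "orthonormal_basis b" and \<Phi>: "complex_linear \<Phi>"
  obtains w :: "'r \<Rightarrow> complex^('d \<times> 'd)" where
    "\<And>A. Re (cinner v (quadratic_map \<Phi> (class_of A) *v v)) =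
      (\<Sum>i\<in>UNIV. Re (cinner (w i) (fisher_map b (class_of A) *v w i)))"
proof -
  obtain w where w: "\<And>E i. (mat_adjoint (\<Phi> E) *v v) $ i = cinner (vectorize b E) (w i)"
    using adjoint_apply_vectorize[OF b \<Phi>, of v] by blast
  have norm: "(norm (mat_adjoint (\<Phi> E) *v v))\<^sup>2 = (\<Sum>i\<in>UNIV. (cmod (cinner (vectorize b E) (w i)))\<^sup>2)"
    for E
    by (simp add: norm_vec_def L2_set_def sum_nonneg w)
  have "Re (cinner v (quadratic_map \<Phi> (class_of A) *v v)) =
      (\<Sum>i\<in>UNIV. Re (cinner (w i) (fisher_map b (class_of A) *v w i)))" for A
    unfolding fisher_map_def quadratic_map_class_of[OF \<Phi>]
      quadratic_map_class_of[OF complex_linear_columnvector_vectorize]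
      quadratic_form_quadratic_sum[OF \<Phi>]
      quadratic_form_quadratic_sum[OF complex_linear_columnvector_vectorize]
      norm_adjoint_columnvector norm sum_divide_distrib
    \<comment> \<open>Both sides are now the same double sum, over outcomes and over components,
      with the traces as denominators.\<close>
    by (rule sum.swap)
  then show thesis by (rule that)
qed

theorem proposition4p8:
  fixes b :: "'d::finite \<Rightarrow> complex^'d"
    and \<Phi> :: "complex^'d^'d \<Rightarrow> complex^'r::finite^'D::finite"
  assumes "orthonormal_basis b"
    and "complex_linear \<Phi>"
  shows "at_least_as_informative (fisher_map b) (quadratic_map \<Phi>)"
  unfolding at_least_as_informative_def
proof (intro allI impI)
  fix A B
  assume "fisher_map b (class_of A) \<sqsubseteq> fisher_map b (class_of B)"
  then have le: "Re (cinner u (fisher_map b (class_of A) *v u)) \<le>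
      Re (cinner u (fisher_map b (class_of B) *v u))" for u
    by (simp add: psd_le_def psd_def matrix_vector_mult_diff_rdistrib cinner_diff_right)
  have "Re (cinner v (quadratic_map \<Phi> (class_of A) *v v)) \<le>
      Re (cinner v (quadratic_map \<Phi> (class_of B) *v v))" for v
  proof -
    obtain w :: "'r \<Rightarrow> complex^('d \<times> 'd)" where "\<And>A. Re (cinner v (quadratic_map \<Phi> (class_of A) *v v)) =
        (\<Sum>i\<in>UNIV. Re (cinner (w i) (fisher_map b (class_of A) *v w i)))"
      using quadratic_form_eq_sum_fisher[OF assms, of v] by blast
    then show ?thesis by (simp add: sum_mono le)
  qed
  \<comment> \<open>\<open>psd\<close> demands selfadjointness as well as a nonnegative real part of
    the quadratic form.\<close>
  moreover have "selfadjoint (quadratic_map \<Phi> a)" for a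
    using order_preserving_quadratic_map[OF assms(2)] by (simp add: order_preserving_def)
  ultimately show "quadratic_map \<Phi> (class_of A) \<sqsubseteq> quadratic_map \<Phi> (class_of B)"
    by (simp add: psd_le_def psd_def selfadjoint_diff matrix_vector_mult_diff_rdistrib
        cinner_diff_right)
qed

end
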